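(* Let $H$ be a bounded hoop algebra, $F$ a filter of $H$, and $s:H\to H$ a square root on $H$. Then the map $s_F:\frac{H}{F}\to\frac{H}{F}$ defined by $s_F\left(\frac{x}{F}\right)=\frac{s(x)}{F}$ for every $x\in H$ is a square root on the quotient hoop $\frac{H}{F}$.
   Context: A hoop algebra is an algebra $(H;\odot,\rightarrow,1)$ of type $(2,2,0)$ such that $(H;\odot,1)$ is a commutative monoid and, for all $x,y,z\in H$: $x\rightarrow x=1$; $x\odot(x\rightarrow y)=y\odot(y\rightarrow x)$; $(x\odot y)\rightarrow z=x\rightarrow(y\rightarrow z)$. It is partially ordered by $x\le y$ iff $x\rightarrow y=1$. $H$ is bounded if it has a least element $0$. A square root on $H$ is a map $s:H\to H$ such that (1) $s(x)\odot s(x)=x$ for every $x\in H$; (2) for all $x,y\in H$, if $y\odot y\le x$ then $y\le s(x)$. A filter of $H$ is a subset $F\subseteq H$ with $1\in F$, closed under $\odot$, and upward closed. A filter $F$ induces a congruence $x\equiv_F y$ iff $x\rightarrow y\in F$ and $y\rightarrow x\in F$; the class of $x$ is denoted $\frac{x}{F}$, and the set of classes $\frac{H}{F}$ is a hoop algebra under $\frac{x}{F}\odot\frac{y}{F}=\frac{x\odot y}{F}$, $\frac{x}{F}\rightarrow\frac{y}{F}=\frac{x\rightarrow y}{F}$, with unit $\frac{1}{F}$. *)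

theory Defs
  imports "HOL-Algebra.Group"
begin

record 'a hoop = "'a monoid" +
  imp :: "'a \<Rightarrow> 'a \<Rightarrow> 'a"  (infixr "\<rightharpoonup>\<index>" 65)

locale hoop = comm_monoid H for H (structure) +
  assumes imp_closed [intro, simp]:
      "\<lbrakk>x \<in> carrier H; y \<in> carrier H\<rbrakk> \<Longrightarrow> x \<rightharpoonup> y \<in> carrier H"
    and imp_self [simp]: "x \<in> carrier H \<Longrightarrow> x \<rightharpoonup> x = \<one>"
    and divisibility: "\<lbrakk>x \<in> carrier H; y \<in> carrier H\<rbrakk>
      \<Longrightarrow> x \<otimes> (x \<rightharpoonup> y) = y \<otimes> (y \<rightharpoonup> x)"
    and imp_mult: "\<lbrakk>x \<in> carrier H; y \<in> carrier H; z \<in> carrier H\<rbrakk>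
      \<Longrightarrow> (x \<otimes> y) \<rightharpoonup> z = x \<rightharpoonup> (y \<rightharpoonup> z)"

definition hoop_le :: "('a, 'b) hoop_scheme \<Rightarrow> 'a \<Rightarrow> 'a \<Rightarrow> bool"  (infix "\<preceq>\<index>" 50)
  where "x \<preceq>\<^bsub>H\<^esub> y \<longleftrightarrow> x \<rightharpoonup>\<^bsub>H\<^esub> y = \<one>\<^bsub>H\<^esub>"

locale bounded_hoop = hoop +
  assumes ex_least: "\<exists>z\<in>carrier H. \<forall>x\<in>carrier H. z \<preceq> x"

locale hoop_square_root = hoop +
  fixes s :: "'a \<Rightarrow> 'a"
  assumes sqrt_closed: "x \<in> carrier H \<Longrightarrow> s x \<in> carrier H"
    and sqrt_square: "x \<in> carrier H \<Longrightarrow> s x \<otimes> s x = x"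
    and sqrt_greatest: "\<lbrakk>x \<in> carrier H; y \<in> carrier H; y \<otimes> y \<preceq> x\<rbrakk> \<Longrightarrow> y \<preceq> s x"

locale hoop_filter = hoop +
  fixes F :: "'a set"
  assumes filter_subset: "F \<subseteq> carrier H"
    and filter_one: "\<one> \<in> F"
    and filter_mult: "\<lbrakk>x \<in> F; y \<in> F\<rbrakk> \<Longrightarrow> x \<otimes> y \<in> F"
    and filter_up: "\<lbrakk>x \<in> F; y \<in> carrier H; x \<preceq> y\<rbrakk> \<Longrightarrow> y \<in> F"

definition filter_cong :: "('a, 'b) hoop_scheme \<Rightarrow> 'a set \<Rightarrow> ('a \<times> 'a) set"
  where "filter_cong H F = {(x, y) \<in> carrier H \<times> carrier H.
    x \<rightharpoonup>\<^bsub>H\<^esub> y \<in> F \<and> y \<rightharpoonup>\<^bsub>H\<^esub> x \<in> F}"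

definition filter_class :: "('a, 'b) hoop_scheme \<Rightarrow> 'a set \<Rightarrow> 'a \<Rightarrow> 'a set"
  where "filter_class H F x = filter_cong H F `` {x}"

text \<open>
  The operations of the quotient are written without choosing representatives: the union runs over
  classes that all coincide when \<open>F\<close> is a filter, as \<open>hoop_quotient_mult\<close> and
  \<open>hoop_quotient_imp\<close> below confirm.
\<close>

definition hoop_quotient :: "('a, 'b) hoop_scheme \<Rightarrow> 'a set \<Rightarrow> 'a set hoop"
  where "hoop_quotient H F =
    \<lparr>carrier = carrier H // filter_cong H F,
     monoid.mult = (\<lambda>X Y. \<Union>x\<in>X. \<Union>y\<in>Y. filter_class H F (x \<otimes>\<^bsub>H\<^esub> y)),
     one = filter_class H F \<one>\<^bsub>H\<^esub>,
     imp = (\<lambda>X Y. \<Union>x\<in>X. \<Union>y\<in>Y. filter_class H F (x \<rightharpoonup>\<^bsub>H\<^esub> y))\<rparr>"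

context hoop
begin

lemma one_imp [simp]:
  assumes x: "x \<in> carrier H" shows "\<one> \<rightharpoonup> x = x"
proof -
  have a: "\<one> \<rightharpoonup> (y \<rightharpoonup> z) = y \<rightharpoonup> z" if "y \<in> carrier H" "z \<in> carrier H" for y z
    using imp_mult[of \<one> y z] that by simp
  have b: "x \<otimes> (x \<rightharpoonup> \<one>) = \<one> \<rightharpoonup> x" if "x \<in> carrier H" for x
    using divisibility[of x \<one>] that by simp
  have c: "(\<one> \<rightharpoonup> x) \<rightharpoonup> \<one> = \<one>" if "x \<in> carrier H" for x
  proof -
    have "(\<one> \<rightharpoonup> x) \<rightharpoonup> \<one> = ((x \<rightharpoonup> \<one>) \<otimes> x) \<rightharpoonup> \<one>"
      using b[of x] that by (simp add: m_comm)
    also have "\<dots> = \<one>" using that by (simp add: imp_mult)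
    finally show ?thesis .
  qed
  have d: "(x \<rightharpoonup> \<one>) \<rightharpoonup> \<one> = \<one>" using c[of "x \<rightharpoonup> \<one>"] a[of x \<one>] x by simp
  have "(\<one> \<rightharpoonup> x) \<rightharpoonup> x = ((x \<rightharpoonup> \<one>) \<otimes> x) \<rightharpoonup> x"
    using b[of x] x by (simp add: m_comm)
  also have "\<dots> = \<one>" using x d by (simp add: imp_mult)
  finally have e: "(\<one> \<rightharpoonup> x) \<rightharpoonup> x = \<one>" .
  have "x \<rightharpoonup> (\<one> \<rightharpoonup> x) = \<one>"
    using imp_mult[of x \<one> x] x by simp
  with e divisibility[of "\<one> \<rightharpoonup> x" x] x show ?thesis by simp
qed

lemma imp_one [simp]: "x \<in> carrier H \<Longrightarrow> x \<rightharpoonup> \<one> = \<one>"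
  using divisibility[of x \<one>] imp_mult[of "x \<rightharpoonup> \<one>" x \<one>]
  by (metis imp_closed imp_self m_comm one_closed one_imp r_one l_one)

lemma le_refl: "x \<in> carrier H \<Longrightarrow> x \<preceq> x"
  by (simp add: hoop_le_def)

lemma le_antisym: "\<lbrakk>x \<in> carrier H; y \<in> carrier H; x \<preceq> y; y \<preceq> x\<rbrakk> \<Longrightarrow> x = y"
  using divisibility[of x y] by (simp add: hoop_le_def)

lemma residuation:
  "\<lbrakk>x \<in> carrier H; y \<in> carrier H; z \<in> carrier H\<rbrakk> \<Longrightarrow> x \<otimes> y \<preceq> z \<longleftrightarrow> x \<preceq> y \<rightharpoonup> z"
  by (simp add: hoop_le_def imp_mult)

lemma mult_le: "\<lbrakk>x \<in> carrier H; y \<in> carrier H\<rbrakk> \<Longrightarrow> x \<otimes> y \<preceq> x"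
  using imp_mult[of y x x] by (simp add: hoop_le_def m_comm)

lemma le_trans:
  assumes "x \<in> carrier H" "y \<in> carrier H" "z \<in> carrier H" "x \<preceq> y" "y \<preceq> z"
  shows "x \<preceq> z"
proof -
  have "x = y \<otimes> (y \<rightharpoonup> x)" using divisibility[of x y] assms by (simp add: hoop_le_def)
  hence "x \<rightharpoonup> z = (y \<rightharpoonup> x) \<rightharpoonup> (y \<rightharpoonup> z)"
    using assms imp_mult[of "y \<rightharpoonup> x" y z] by (metis imp_closed m_comm)
  thus ?thesis using assms by (simp add: hoop_le_def)
qed

lemma mult_mono_left:
  assumes "x \<in> carrier H" "y \<in> carrier H" "z \<in> carrier H" "x \<preceq> y"
  shows "x \<otimes> z \<preceq> y \<otimes> z"
  using assms residuation[of x z "y \<otimes> z"] residuation[of y z "y \<otimes> z"]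
    le_refl[of "y \<otimes> z"] le_trans[of x y "z \<rightharpoonup> (y \<otimes> z)"] by simp

lemma modus_ponens_le: "\<lbrakk>x \<in> carrier H; y \<in> carrier H\<rbrakk> \<Longrightarrow> (x \<rightharpoonup> y) \<otimes> x \<preceq> y"
  by (simp add: residuation le_refl)

end

context hoop_filter
begin

lemma filter_carrier [simp]: "x \<in> F \<Longrightarrow> x \<in> carrier H"
  using filter_subset by blast

lemma filter_imp_iff:
  assumes "x \<in> carrier H" "y \<in> carrier H"
  shows "x \<rightharpoonup> y \<in> F \<longleftrightarrow> (\<exists>f\<in>F. f \<otimes> x \<preceq> y)"
  using assms filter_up[of _ "x \<rightharpoonup> y"] residuation modus_ponens_le by (metis filter_carrier imp_closed)

lemma filter_imp_trans:
  assumes c: "x \<in> carrier H" "y \<in> carrier H" "z \<in> carrier H"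
    and xy: "x \<rightharpoonup> y \<in> F" and yz: "y \<rightharpoonup> z \<in> F"
  shows "x \<rightharpoonup> z \<in> F"
proof -
  let ?f = "x \<rightharpoonup> y" and ?g = "y \<rightharpoonup> z"
  have "(?f \<otimes> x) \<otimes> ?g \<preceq> y \<otimes> ?g" using c by (intro mult_mono_left modus_ponens_le) auto
  moreover have "y \<otimes> ?g \<preceq> z" using modus_ponens_le[of y z] c by (simp add: m_comm)
  ultimately have "(?f \<otimes> x) \<otimes> ?g \<preceq> z"
    using c le_trans[of "(?f \<otimes> x) \<otimes> ?g" "y \<otimes> ?g" z] by simp
  hence "(?f \<otimes> ?g) \<otimes> x \<preceq> z" using c by (simp add: m_ac)
  thus ?thesis using filter_mult[OF xy yz] filter_imp_iff c by blast
qed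

lemma equiv_filter_cong: "equiv (carrier H) (filter_cong H F)"
  by (rule equivI)
    (auto simp: filter_cong_def refl_on_def sym_def trans_def filter_one intro: filter_imp_trans)

lemma filter_mult_mono:
  assumes c: "x \<in> carrier H" "x' \<in> carrier H" "y \<in> carrier H" "x \<rightharpoonup> x' \<in> F"
  shows "(x \<otimes> y) \<rightharpoonup> (x' \<otimes> y) \<in> F"
proof -
  have "((x \<rightharpoonup> x') \<otimes> x) \<otimes> y \<preceq> x' \<otimes> y" using c by (intro mult_mono_left modus_ponens_le) auto
  hence "(x \<rightharpoonup> x') \<otimes> (x \<otimes> y) \<preceq> x' \<otimes> y" using c by (simp add: m_assoc)
  thus ?thesis using c filter_imp_iff[of "x \<otimes> y" "x' \<otimes> y"] by auto
qed

lemma filter_imp_mono: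
  assumes c: "x \<in> carrier H" "y \<in> carrier H" "y' \<in> carrier H" "y \<rightharpoonup> y' \<in> F"
  shows "(x \<rightharpoonup> y) \<rightharpoonup> (x \<rightharpoonup> y') \<in> F"
proof -
  have "((x \<rightharpoonup> y) \<otimes> x) \<rightharpoonup> y \<in> F"
    using modus_ponens_le[of x y] c filter_one by (simp add: hoop_le_def)
  hence "((x \<rightharpoonup> y) \<otimes> x) \<rightharpoonup> y' \<in> F"
    using c filter_imp_trans[of "(x \<rightharpoonup> y) \<otimes> x" y y'] by simp
  thus ?thesis using c imp_mult[of "x \<rightharpoonup> y" x y'] by simp
qed

lemma filter_imp_antimono:
  assumes c: "x \<in> carrier H" "x' \<in> carrier H" "y \<in> carrier H" "x' \<rightharpoonup> x \<in> F"
  shows "(x \<rightharpoonup> y) \<rightharpoonup> (x' \<rightharpoonup> y) \<in> F"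
proof -
  let ?i = "x \<rightharpoonup> y"
  have "(x' \<otimes> ?i) \<rightharpoonup> (x \<otimes> ?i) \<in> F" using c by (intro filter_mult_mono) auto
  moreover have "(x \<otimes> ?i) \<rightharpoonup> y \<in> F"
    using modus_ponens_le[of x y] c filter_one by (simp add: hoop_le_def m_comm)
  ultimately have "(x' \<otimes> ?i) \<rightharpoonup> y \<in> F"
    using c filter_imp_trans[of "x' \<otimes> ?i" "x \<otimes> ?i" y] by simp
  thus ?thesis using c imp_mult[of ?i x' y] by (simp add: m_comm)
qed

lemma filter_cong_mult:
  assumes "(x, x') \<in> filter_cong H F" "(y, y') \<in> filter_cong H F"
  shows "(x \<otimes> y, x' \<otimes> y') \<in> filter_cong H F"
proof -
  have c: "x \<in> carrier H" "x' \<in> carrier H" "y \<in> carrier H" "y' \<in> carrier H"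
    using assms by (auto simp: filter_cong_def)
  have "(x \<otimes> y, x' \<otimes> y) \<in> filter_cong H F"
    using assms c by (auto simp: filter_cong_def intro: filter_mult_mono)
  moreover have "(y \<otimes> x', y' \<otimes> x') \<in> filter_cong H F"
    using assms c by (auto simp: filter_cong_def intro: filter_mult_mono)
  ultimately show ?thesis using c equiv_filter_cong by (metis equiv_def m_comm transD)
qed

lemma filter_cong_imp:
  assumes "(x, x') \<in> filter_cong H F" "(y, y') \<in> filter_cong H F"
  shows "(x \<rightharpoonup> y, x' \<rightharpoonup> y') \<in> filter_cong H F"
proof -
  have c: "x \<in> carrier H" "x' \<in> carrier H" "y \<in> carrier H" "y' \<in> carrier H"
    using assms by (auto simp: filter_cong_def)
  have "(x \<rightharpoonup> y, x' \<rightharpoonup> y) \<in> filter_cong H F"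
    using assms c by (auto simp: filter_cong_def intro: filter_imp_antimono)
  moreover have "(x' \<rightharpoonup> y, x' \<rightharpoonup> y') \<in> filter_cong H F"
    using assms c by (auto simp: filter_cong_def intro: filter_imp_mono)
  ultimately show ?thesis using equiv_filter_cong by (metis equiv_def transD)
qed

lemma hoop_quotient_carrier: "carrier (hoop_quotient H F) = filter_class H F ` carrier H"
  by (auto simp: hoop_quotient_def filter_class_def quotient_def)

lemma hoop_quotient_one: "\<one>\<^bsub>hoop_quotient H F\<^esub> = filter_class H F \<one>"
  by (simp add: hoop_quotient_def)

lemma hoop_quotient_mult:
  assumes "x \<in> carrier H" "y \<in> carrier H"
  shows "filter_class H F x \<otimes>\<^bsub>hoop_quotient H F\<^esub> filter_class H F y = filter_class H F (x \<otimes> y)"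
proof -
  have "(\<lambda>x y. filter_class H F (x \<otimes> y)) respects2 filter_cong H F"
    using equiv_filter_cong filter_cong_mult
    by (auto simp: congruent2_def filter_class_def intro!: equiv_class_eq)
  from UN_equiv_class2[OF equiv_filter_cong equiv_filter_cong this assms]
  show ?thesis by (simp add: hoop_quotient_def filter_class_def)
qed

lemma hoop_quotient_imp:
  assumes "x \<in> carrier H" "y \<in> carrier H"
  shows "filter_class H F x \<rightharpoonup>\<^bsub>hoop_quotient H F\<^esub> filter_class H F y = filter_class H F (x \<rightharpoonup> y)"
proof -
  have "(\<lambda>x y. filter_class H F (x \<rightharpoonup> y)) respects2 filter_cong H F"
    using equiv_filter_cong filter_cong_imp
    by (auto simp: congruent2_def filter_class_def intro!: equiv_class_eq)
  from UN_equiv_class2[OF equiv_filter_cong equiv_filter_cong this assms]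
  show ?thesis by (simp add: hoop_quotient_def filter_class_def)
qed

lemma hoop_hoop_quotient: "hoop (hoop_quotient H F)"
proof -
  note s = hoop_quotient_carrier hoop_quotient_one hoop_quotient_mult hoop_quotient_imp
  have "comm_monoid (hoop_quotient H F)"
    by (rule comm_monoidI) (auto simp: s m_ac)
  thus ?thesis
    by (intro hoop.intro hoop_axioms.intro) (auto simp: s divisibility imp_mult)
qed

end

end

theory Submission
  imports Defs
begin

text \<open>
  Everything rests on a version of the maximality of \<open>s\<close> modulo the filter: if
  \<open>y \<odot> y \<rightarrow> x\<close> lies in \<open>F\<close>, then so does \<open>y \<rightarrow> s x\<close>. Indeed, \<open>f \<odot> (y \<odot> y) \<le> x\<close> for some
  \<open>f \<in> F\<close>, hence \<open>(f \<odot> y) \<odot> (f \<odot> y) \<le> f \<odot> (y \<odot> y) \<le> x\<close> and \<open>f \<odot> y \<le> s x\<close>. Applied to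
  \<open>y = s z\<close>, this also shows that \<open>s\<close> respects the congruence.
\<close>

context hoop_filter
begin

lemma filter_class_eq_iff:
  assumes "x \<in> carrier H" "y \<in> carrier H"
  shows "filter_class H F x = filter_class H F y \<longleftrightarrow> x \<rightharpoonup> y \<in> F \<and> y \<rightharpoonup> x \<in> F"
  using eq_equiv_class_iff[OF equiv_filter_cong assms] assms
  by (simp add: filter_class_def filter_cong_def)

text \<open>A class equals that of \<open>\<one>\<close> exactly when its representative lies in
  \<open>F\<close>. This turns maximality in the quotient into
  \<open>filter_imp_sqrt\<close>.\<close>

lemma filter_class_le_iff:
  assumes "x \<in> carrier H" "y \<in> carrier H"
  shows "filter_class H F x \<preceq>\<^bsub>hoop_quotient H F\<^esub> filter_class H F y \<longleftrightarrow> x \<rightharpoonup> y \<in> F"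
  using assms filter_one
  by (simp add: hoop_le_def hoop_quotient_imp hoop_quotient_one filter_class_eq_iff)

end

locale hoop_filter_square_root = hoop_filter + hoop_square_root
begin

lemma filter_imp_sqrt:
  assumes c: "x \<in> carrier H" "y \<in> carrier H" and yx: "(y \<otimes> y) \<rightharpoonup> x \<in> F"
  shows "y \<rightharpoonup> s x \<in> F"
proof -
  obtain f where f: "f \<in> F" "f \<otimes> (y \<otimes> y) \<preceq> x"
    using yx c filter_imp_iff[of "y \<otimes> y" x] by auto
  have "(f \<otimes> y) \<otimes> (f \<otimes> y) = (f \<otimes> (y \<otimes> y)) \<otimes> f"
    using f c by (simp add: m_ac)
  hence "(f \<otimes> y) \<otimes> (f \<otimes> y) \<preceq> x"
    using f c mult_le[of "f \<otimes> (y \<otimes> y)" f] le_trans[of _ "f \<otimes> (y \<otimes> y)" x] by simp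
  hence "f \<otimes> y \<preceq> s x"
    using f c by (intro sqrt_greatest) auto
  thus ?thesis
    using f c filter_imp_iff[of y "s x"] sqrt_closed by blast
qed

lemma filter_sqrt_mono:
  assumes "x \<in> carrier H" "y \<in> carrier H" "x \<rightharpoonup> y \<in> F"
  shows "s x \<rightharpoonup> s y \<in> F"
  using assms filter_imp_sqrt[of y "s x"] by (simp add: sqrt_closed sqrt_square)

lemma filter_class_sqrt_cong:
  assumes "x \<in> carrier H" "y \<in> carrier H" "filter_class H F x = filter_class H F y"
  shows "filter_class H F (s x) = filter_class H F (s y)"
  using assms by (simp add: filter_class_eq_iff sqrt_closed filter_sqrt_mono)

lemma ex_quotient_map:
  "\<exists>t. \<forall>x\<in>carrier H. t (filter_class H F x) = filter_class H F (s x)"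
proof -
  \<comment> \<open>\<open>?r\<close> picks a representative of each class; it may differ from
    \<open>x\<close> but has the same class, so \<open>filter_class_sqrt_cong\<close>
    applies.\<close>
  let ?r = "inv_into (carrier H) (filter_class H F)"
  have "filter_class H F (s (?r (filter_class H F x))) = filter_class H F (s x)"
    if "x \<in> carrier H" for x
    using that by (intro filter_class_sqrt_cong inv_into_into f_inv_into_f imageI)
  thus ?thesis
    by (intro exI[of _ "\<lambda>X. filter_class H F (s (?r X))"]) simp
qed

lemma hoop_square_root_quotient:
  assumes t: "\<And>x. x \<in> carrier H \<Longrightarrow> t (filter_class H F x) = filter_class H F (s x)"
  shows "hoop_square_root (hoop_quotient H F) t"
  by (intro hoop_square_root.intro hoop_square_root_axioms.intro hoop_hoop_quotient)
    (auto simp: hoop_quotient_carrier hoop_quotient_mult t sqrt_closed sqrt_square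
      filter_class_le_iff filter_imp_sqrt)

end

text \<open>The first conjunct expresses well-definedness. The second ranges over all
  \<open>s\<^sub>F\<close> because the equation fixes a total HOL function only on the
  classes.\<close>

theorem proposition4p4:
  fixes H :: "('a, 'b) hoop_scheme" and F :: "'a set" and s :: "'a \<Rightarrow> 'a"
  assumes "bounded_hoop H" and "hoop_filter H F" and "hoop_square_root H s"
  shows "(\<exists>s\<^sub>F. \<forall>x\<in>carrier H. s\<^sub>F (filter_class H F x) = filter_class H F (s x)) \<and>
    (\<forall>s\<^sub>F. (\<forall>x\<in>carrier H. s\<^sub>F (filter_class H F x) = filter_class H F (s x)) \<longrightarrow>
      hoop_square_root (hoop_quotient H F) s\<^sub>F)"
proof -
  interpret hoop_filter_square_root H F s
    using assms(2,3) by (rule hoop_filter_square_root.intro)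
  show ?thesis
    using ex_quotient_map hoop_square_root_quotient by blast
qed

end
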